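(* For every nonempty signed graph $\Sigma=(G,\sigma)$ with vertex set $V$, the value $\overline{\vartheta}_{\mathrm b}(\Sigma)$ is the optimum of the semidefinite program: minimize $t$ over $t\in\mathbb R$ and real symmetric matrices $X,Y$ indexed by $V$, subject to $$X\succeq0,\quad Y\succeq0,\quad X_{vv}=t-1\ (v\in V),\quad Y_{vv}=t\ (v\in V),\quad X_{uv}-\sigma(uv)Y_{uv}=-1\ (uv\in E(\Sigma)),$$ where the last constraint is imposed for every signed edge (so for both signs when $u,v$ are joined by edges of both signs).
   Context: Signed graphs. A signed graph is a pair $\Sigma=(G,\sigma)$ with $G$ a finite graph and $\sigma:E(G)\to\{+1,-1\}$. Positive loops are allowed, negative loops are excluded; between two distinct vertices there may be both a positive and a negative edge (a digon); repeated edges of the same sign are immaterial. Convention: every signed graph is replaced by its completion having a positive loop at every vertex. Signed homomorphism. A signed homomorphism $\Sigma\to\Pi$ consists of a switching function $\tau:V(\Sigma)\to\{\pm1\}$ and a vertex map $f:V(\Sigma)\to V(\Pi)$ such that for every edge $e=uv$ of $\Sigma$ the signed graph $\Pi$ contains an edge between $f(u)$ and $f(v)$ of sign $\tau(u)\sigma(e)\tau(v)$. Signed sphere. Let $\mathcal H=\mathcal H_+\oplus\mathcal H_-$ be a finite-dimensional real inner-product space (orthogonal direct sum) and $R(a,b)=(a,-b)$. For $t\ge1$ put $\gamma_t=\frac1{1-2t}$. The (infinite) signed graph $\mathcal S_t(\mathcal H,R)$ has vertex set $\{x\in\mathcal H:\|x\|=1,\ \langle x,Rx\rangle=\gamma_t\}$;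 $x,y$ are joined by a negative edge iff $\langle x,y\rangle=\gamma_t$, and by a positive edge iff $\langle x,Ry\rangle=\gamma_t$ (both may hold; $x=y$ allowed). Balanced theta parameter. For nonempty $\Sigma$ (with positive loops adjoined), $\overline{\vartheta}_{\mathrm b}(\Sigma)=\inf\{t\ge1:\text{there is a signed homomorphism }\Sigma\to\mathcal S_t(\mathcal H,R)\text{ for some finite-dimensional }\mathcal H=\mathcal H_+\oplus\mathcal H_-\}$. *)

theory Defs
  imports Complex_Main "Jordan_Normal_Form.Matrix"
begin

section \<open>Signed graphs\<close>

text \<open>
  A signed edge is a pair of its set of endpoints (\<open>{u, v}\<close>, or \<open>{v}\<close> for a loop) and its sign
  \<open>1\<close> or \<open>-1\<close>.  Thus two vertices can be joined by one edge of each sign (a digon), while repeated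
  edges of the same sign are identified.  The signature \<open>\<sigma>\<close> is the second projection.
  The vertex set may be infinite here, because the signed sphere is a signed graph as well.
\<close>

record 'v sgraph =
  verts :: "'v set"
  sedges :: "('v set \<times> int) set"

definition signed_graph :: "'v sgraph \<Rightarrow> bool" where
  "signed_graph S \<longleftrightarrow>
    (\<forall>(e, s) \<in> sedges S.
      s \<in> {1, -1} \<and>
      (\<exists>u \<in> verts S. \<exists>v \<in> verts S. e = {u, v} \<and> (u = v \<longrightarrow> s \<noteq> -1)))"

definition add_pos_loops :: "'v sgraph \<Rightarrow> 'v sgraph" where
  "add_pos_loops S = \<lparr>verts = verts S, sedges = sedges S \<union> {({v}, 1) | v. v \<in> verts S}\<rparr>"

definition signed_hom ::
  "'v sgraph \<Rightarrow> 'w sgraph \<Rightarrow> ('v \<Rightarrow> int) \<Rightarrow> ('v \<Rightarrow> 'w) \<Rightarrow> bool" where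
  "signed_hom S T \<tau> f \<longleftrightarrow>
    \<tau> \<in> verts S \<rightarrow> {1, -1} \<and>
    f \<in> verts S \<rightarrow> verts T \<and>
    (\<forall>u \<in> verts S. \<forall>v \<in> verts S. \<forall>s.
      ({u, v}, s) \<in> sedges S \<longrightarrow> ({f u, f v}, \<tau> u * s * \<tau> v) \<in> sedges T)"


section \<open>The signed sphere\<close>

text \<open>
  Up to isometry, a finite-dimensional real inner product space with an orthogonal decomposition
  \<open>H = H\<^sub>+ \<oplus> H\<^sub>-\<close> is the space of pairs in \<open>\<real>\<^sup>p \<times> \<real>\<^sup>q\<close> with \<open>p = dim H\<^sub>+\<close> and \<open>q = dim H\<^sub>-\<close>,
  either of which may be \<open>0\<close>.  A pair \<open>(a, b)\<close> stands for \<open>a + b\<close>.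
\<close>

type_synonym hvec = "real vec \<times> real vec"

definition H :: "nat \<Rightarrow> nat \<Rightarrow> hvec set" where
  "H p q = carrier_vec p \<times> carrier_vec q"

definition hinner :: "hvec \<Rightarrow> hvec \<Rightarrow> real" where
  "hinner x y = fst x \<bullet> fst y + snd x \<bullet> snd y"

definition hnorm :: "hvec \<Rightarrow> real" where
  "hnorm x = sqrt (hinner x x)"

definition R :: "hvec \<Rightarrow> hvec" where
  "R x = (fst x, - snd x)"

definition gam :: "real \<Rightarrow> real" where
  "gam t = 1 / (1 - 2 * t)"

definition sphere_verts :: "nat \<Rightarrow> nat \<Rightarrow> real \<Rightarrow> hvec set" where
  "sphere_verts p q t = {x \<in> H p q. hnorm x = 1 \<and> hinner x (R x) = gam t}"

definition signed_sphere :: "nat \<Rightarrow> nat \<Rightarrow> real \<Rightarrow> hvec sgraph" where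
  "signed_sphere p q t =
    \<lparr>verts = sphere_verts p q t,
     sedges =
       {({x, y}, -1) | x y. x \<in> sphere_verts p q t \<and> y \<in> sphere_verts p q t \<and>
                            hinner x y = gam t} \<union>
       {({x, y}, 1) | x y. x \<in> sphere_verts p q t \<and> y \<in> sphere_verts p q t \<and>
                           hinner x (R y) = gam t}\<rparr>"


section \<open>The balanced theta parameter\<close>

text \<open>
  The infimum is taken in the reals, where it is only meaningful for a nonempty set that is bounded
  below.  Both hold for finite nonempty signed graphs.
\<close>

definition theta_b :: "'v sgraph \<Rightarrow> real" where
  "theta_b S =
    Inf {t. t \<ge> 1 \<and> (\<exists>p q \<tau> f. signed_hom (add_pos_loops S) (signed_sphere p q t) \<tau> f)}"


section \<open>The semidefinite program\<close>

text \<open>Real matrices indexed by \<open>V\<close> are functions of two arguments; only values on \<open>V\<close> matter.\<close>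

definition symmetric_on :: "'v set \<Rightarrow> ('v \<Rightarrow> 'v \<Rightarrow> real) \<Rightarrow> bool" where
  "symmetric_on V M \<longleftrightarrow> (\<forall>u \<in> V. \<forall>v \<in> V. M u v = M v u)"

definition psd_on :: "'v set \<Rightarrow> ('v \<Rightarrow> 'v \<Rightarrow> real) \<Rightarrow> bool" where
  "psd_on V M \<longleftrightarrow>
    symmetric_on V M \<and> (\<forall>z :: 'v \<Rightarrow> real. 0 \<le> (\<Sum>u\<in>V. \<Sum>v\<in>V. z u * M u v * z v))"

definition sdp_feasible ::
  "'v sgraph \<Rightarrow> real \<Rightarrow> ('v \<Rightarrow> 'v \<Rightarrow> real) \<Rightarrow> ('v \<Rightarrow> 'v \<Rightarrow> real) \<Rightarrow> bool" where
  "sdp_feasible S t X Y \<longleftrightarrow>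
    psd_on (verts S) X \<and> psd_on (verts S) Y \<and>
    (\<forall>v \<in> verts S. X v v = t - 1) \<and>
    (\<forall>v \<in> verts S. Y v v = t) \<and>
    (\<forall>u \<in> verts S. \<forall>v \<in> verts S. \<forall>s.
      ({u, v}, s) \<in> sedges S \<longrightarrow> X u v - of_int s * Y u v = -1)"

end

theory Submission
  imports Defs
begin

text \<open>
  Write a vertex of the sphere as \<open>(a, b)\<close>.  Scaling by \<open>2t - 1 = -1 / \<gamma>\<^sub>t\<close> turns the defining
  conditions of the signed sphere into the constraints of the program for the Gram matrices \<open>X\<close> of
  the \<open>a\<close>-components and \<open>Y\<close> of the \<open>b\<close>-components, the latter conjugated by the switching signs.
  Conversely, positive semidefinite matrices are Gram matrices, so \<open>t \<ge> 1\<close> admits a homomorphism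
  exactly if it is feasible.  The value \<open>t = |V|\<close> is feasible with \<open>X = tI - J\<close> and \<open>Y = tI\<close>, and
  the infimum is attained because the entries of feasible matrices are bounded in terms of \<open>t\<close>.
\<close>

section \<open>Positive semidefinite matrices\<close>

lemma psd_on_two:
  assumes "finite V" "psd_on V M" "u \<in> V" "v \<in> V" "u \<noteq> v"
  shows "0 \<le> a * a * M u u + 2 * a * b * M u v + b * b * M v v"
proof -
  \<comment> \<open>Supported on two indices, this test vector leaves only the 2x2 principal
    submatrix at \<open>u\<close> and \<open>v\<close> in the quadratic form.\<close>
  define z where "z = (\<lambda>x. if x = u then a else if x = v then b else 0)"
  have split: "(\<Sum>x\<in>V. z x * h x) = a * h u + b * h v" for h :: "'a \<Rightarrow> real"
  proof -
    have "(\<Sum>x\<in>V. z x * h x) = (\<Sum>x\<in>{u, v}. z x * h x)"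
      using assms by (intro sum.mono_neutral_right) (auto simp: z_def)
    then show ?thesis using \<open>u \<noteq> v\<close> by (simp add: z_def)
  qed
  have sym: "M v u = M u v"
    using assms unfolding psd_on_def symmetric_on_def by blast
  have "0 \<le> (\<Sum>x\<in>V. \<Sum>y\<in>V. z x * M x y * z y)"
    using assms(2) unfolding psd_on_def by blast
  also have "(\<Sum>x\<in>V. \<Sum>y\<in>V. z x * M x y * z y) = (\<Sum>x\<in>V. z x * (\<Sum>y\<in>V. z y * M x y))"
    by (simp add: sum_distrib_left mult_ac)
  also have "\<dots> = a * a * M u u + 2 * a * b * M u v + b * b * M v v"
    unfolding split by (simp add: sym algebra_simps)
  finally show ?thesis .
qed

lemma psd_on_diag:
  assumes "finite V" "psd_on V M" "v \<in> V"
  shows "0 \<le> M v v"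
proof -
  define z :: "'a \<Rightarrow> real" where "z = (\<lambda>x. if x = v then 1 else 0)"
  have split: "(\<Sum>x\<in>V. z x * h x) = h v" for h :: "'a \<Rightarrow> real"
  proof -
    have "(\<Sum>x\<in>V. z x * h x) = (\<Sum>x\<in>{v}. z x * h x)"
      using assms by (intro sum.mono_neutral_right) (auto simp: z_def)
    then show ?thesis by (simp add: z_def)
  qed
  have "0 \<le> (\<Sum>x\<in>V. \<Sum>y\<in>V. z x * M x y * z y)"
    using assms(2) unfolding psd_on_def by blast
  also have "(\<Sum>x\<in>V. \<Sum>y\<in>V. z x * M x y * z y) = (\<Sum>x\<in>V. z x * (\<Sum>y\<in>V. z y * M x y))"
    by (simp add: sum_distrib_left mult_ac)
  also have "\<dots> = M v v" unfolding split ..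
  finally show ?thesis .
qed

text \<open>The test vectors (1,1) and (1,-1) on \<open>u\<close>, \<open>v\<close> bound the entry
  from both sides. Hence the prescribed diagonals of a feasible pair bound all of its
  entries.\<close>

lemma psd_on_abs_le:
  assumes "finite V" "psd_on V M" "u \<in> V" "v \<in> V"
  shows "\<bar>M u v\<bar> \<le> (M u u + M v v) / 2"
proof (cases "u = v")
  case True
  then show ?thesis using psd_on_diag[OF assms(1,2)] assms by simp
next
  case False
  show ?thesis
    using psd_on_two[OF assms False, of 1 1] psd_on_two[OF assms False, of 1 "-1"] by simp
qed

lemma psd_on_diag_eq_0:
  assumes "finite V" "psd_on V M" "u \<in> V" "w \<in> V" "M w w = 0"
  shows "M u w = 0"
proof (rule ccontr)
  assume nz: "M u w \<noteq> 0"
  then have "u \<noteq> w" using assms by auto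
  \<comment> \<open>With \<open>M w w = 0\<close> the form is linear in the coefficient at
    \<open>w\<close>; this coefficient is chosen so that the form takes the value -1.\<close>
  from psd_on_two[OF assms(1-4) this, of 1 "- (M u u + 1) / (2 * M u w)"]
  have "0 \<le> M u u - (M u u + 1)" using nz assms(5) by (simp add: field_simps)
  then show False by simp
qed

section \<open>Positive semidefinite matrices as Gram matrices, and conversely\<close>

lemma psd_on_insert_schur:
  assumes fin: "finite V" and w: "w \<notin> V" and psd: "psd_on (insert w V) M"
  shows "psd_on V (\<lambda>u v. M u v - M u w * M v w / M w w)"
  unfolding psd_on_def
proof (intro conjI allI)
  show "symmetric_on V (\<lambda>u v. M u v - M u w * M v w / M w w)"
    unfolding symmetric_on_def
  proof (intro ballI)
    fix u v assume "u \<in> V" "v \<in> V"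
    then have "M u v = M v u" using psd by (simp add: psd_on_def symmetric_on_def)
    then show "M u v - M u w * M v w / M w w = M v u - M v w * M u w / M w w"
      by (simp add: mult.commute)
  qed
next
  fix z :: "'a \<Rightarrow> real"
  define b where "b = (\<Sum>u\<in>V. z u * M u w)"
  \<comment> \<open>For \<open>M w w > 0\<close>, this value at \<open>w\<close> minimizes the form
    of \<open>M\<close> over all extensions of \<open>z\<close> to \<open>w\<close>, and the minimum
    is the form of the Schur complement. For \<open>M w w = 0\<close>, division by zero gives
    \<open>c = 0\<close>, and the claim is about the restriction of \<open>M\<close> to
    \<open>V\<close>.\<close>
  define c where "c = - b / M w w"
  define Q where "Q = (\<Sum>u\<in>V. \<Sum>v\<in>V. z u * M u v * z v)"
  have sym: "M w u = M u w" if "u \<in> V" for u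
    using psd that unfolding psd_on_def symmetric_on_def by blast
  have ext: "(\<Sum>x\<in>V. h x * (z(w := c)) x) = (\<Sum>x\<in>V. h x * z x)" for h
    using w by (intro sum.cong) auto
  have row: "(\<Sum>v\<in>insert w V. (z(w := c)) u * M u v * (z(w := c)) v)
      = (z(w := c)) u * M u w * c + (\<Sum>v\<in>V. (z(w := c)) u * M u v * z v)" for u
    using fin w ext[of "\<lambda>v. (z(w := c)) u * M u v"] by simp
  have "0 \<le> (\<Sum>u\<in>insert w V. \<Sum>v\<in>insert w V. (z(w := c)) u * M u v * (z(w := c)) v)"
    using psd unfolding psd_on_def by blast
  also have "\<dots> = (c * M w w * c + (\<Sum>v\<in>V. c * M w v * z v))
      + (\<Sum>u\<in>V. z u * M u w * c + (\<Sum>v\<in>V. z u * M u v * z v))"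
    unfolding row using fin w by (simp, intro sum.cong) auto
  also have "(\<Sum>v\<in>V. c * M w v * z v) = c * b"
    unfolding b_def sum_distrib_left by (intro sum.cong) (auto simp: sym)
  also have "(\<Sum>u\<in>V. z u * M u w * c + (\<Sum>v\<in>V. z u * M u v * z v)) = b * c + Q"
    by (simp add: sum.distrib b_def Q_def sum_distrib_right)
  also have "c * M w w * c + c * b + (b * c + Q) = Q - b * b / M w w"
    by (cases "M w w = 0") (auto simp: c_def field_simps)
  also have "b * b = (\<Sum>u\<in>V. \<Sum>v\<in>V. z u * M u w * (z v * M v w))"
    by (simp add: b_def sum_product)
  also have "Q - \<dots> / M w w
      = (\<Sum>u\<in>V. \<Sum>v\<in>V. z u * (M u v - M u w * M v w / M w w) * z v)"
    by (simp add: Q_def sum_divide_distrib sum_subtractf[symmetric] algebra_simps)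
  finally show "0 \<le> \<dots>" .
qed

text \<open>Cholesky factorization by induction on the index set: splitting off \<open>w\<close>
  leaves the Schur complement on \<open>V\<close>. Coordinates are indexed by \<open>V\<close>
  itself, so each new index brings one new coordinate.\<close>

lemma psd_on_factor:
  assumes "finite V" "psd_on V M"
  shows "\<exists>g. \<forall>u\<in>V. \<forall>v\<in>V. M u v = (\<Sum>k\<in>V. g k u * g k v)"
  using assms
proof (induction V arbitrary: M rule: finite_induct)
  case empty
  show ?case by simp
next
  case (insert w V)
  let ?V = "insert w V"
  have finV: "finite ?V" using insert.hyps by simp
  obtain g where g: "\<And>u v. u \<in> V \<Longrightarrow> v \<in> V \<Longrightarrow>
      M u v - M u w * M v w / M w w = (\<Sum>k\<in>V. g k u * g k v)"
    using insert.IH[OF psd_on_insert_schur[OF insert.hyps insert.prems]] by blast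
  have ww: "0 \<le> M w w" using psd_on_diag[OF finV insert.prems] by simp
  have zero: "M u w = 0" if "M w w = 0" "u \<in> ?V" for u
    using psd_on_diag_eq_0[OF finV insert.prems that(2) _ that(1)] by simp
  have sym: "M w v = M v w" if "v \<in> ?V" for v
    using insert.prems that unfolding psd_on_def symmetric_on_def by blast
  \<comment> \<open>Coordinate \<open>w\<close> carries the rank-one part removed by the Schur
    complement; the vector of \<open>w\<close> vanishes in all other coordinates. If
    \<open>M w w = 0\<close>, the new coordinate is 0 because division by zero gives 0.\<close>
  define g' where "g' = (\<lambda>k u. if k = w then M u w / sqrt (M w w) else if u = w then 0 else g k u)"
  have "M u v = (\<Sum>k\<in>?V. g' k u * g' k v)" if uv: "u \<in> ?V" "v \<in> ?V" for u v
  proof -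
    have "(\<Sum>k\<in>?V. g' k u * g' k v) = g' w u * g' w v + (\<Sum>k\<in>V. g' k u * g' k v)"
      using insert.hyps by simp
    also have "g' w u * g' w v = M u w * M v w / M w w"
      using ww by (simp add: g'_def)
    also have "(\<Sum>k\<in>V. g' k u * g' k v)
        = (if u = w \<or> v = w then 0 else M u v - M u w * M v w / M w w)"
    proof (cases "u = w \<or> v = w")
      case False
      then have "(\<Sum>k\<in>V. g' k u * g' k v) = (\<Sum>k\<in>V. g k u * g k v)"
        using insert.hyps by (intro sum.cong) (auto simp: g'_def)
      then show ?thesis using False uv g by auto
    next
      case True
      then show ?thesis using insert.hyps by (auto simp: g'_def intro!: sum.neutral)
    qed
    finally have "(\<Sum>k\<in>?V. g' k u * g' k v) = M u w * M v w / M w w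
        + (if u = w \<or> v = w then 0 else M u v - M u w * M v w / M w w)" .
    \<comment> \<open>In row or column \<open>w\<close> the rank-one part alone has to give the
      entry. If \<open>M w w = 0\<close>, both sides vanish since column \<open>w\<close> is
      zero.\<close>
    moreover have "M u w * M v w / M w w = M u v" if "u = w \<or> v = w"
    proof (cases "M w w = 0")
      case True
      then show ?thesis using zero[OF True uv(1)] zero[OF True uv(2)] sym[OF uv(2)] that by auto
    next
      case False
      then show ?thesis using sym[OF uv(2)] that by auto
    qed
    ultimately show ?thesis by simp
  qed
  then show ?case by blast
qed

lemma psd_on_gram:
  assumes "finite V" "psd_on V M"
  shows "\<exists>a. (\<forall>v. a v \<in> carrier_vec (card V)) \<and> (\<forall>u\<in>V. \<forall>v\<in>V. M u v = a u \<bullet> a v)"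
proof -
  obtain g where g: "\<And>u v. u \<in> V \<Longrightarrow> v \<in> V \<Longrightarrow> M u v = (\<Sum>k\<in>V. g k u * g k v)"
    using psd_on_factor[OF assms] by blast
  obtain e where e: "bij_betw e {0..<card V} V"
    using ex_bij_betw_nat_finite[OF assms(1)] by blast
  define a where "a = (\<lambda>v. vec (card V) (\<lambda>i. g (e i) v))"
  have "M u v = a u \<bullet> a v" if "u \<in> V" "v \<in> V" for u v
    unfolding g[OF that] sum.reindex_bij_betw[OF e, symmetric]
    by (simp add: a_def scalar_prod_def)
  then show ?thesis by (intro exI[of _ a]) (simp add: a_def)
qed

text \<open>Expanding the inner product in coordinates turns the form into \<open>c\<close> times a
  sum of squares. The weights \<open>d\<close> make room for switching signs, and \<open>c\<close>
  for the scaling by \<open>2 * t - 1\<close>.\<close>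

lemma psd_on_scalar_prod:
  assumes "\<And>v. v \<in> V \<Longrightarrow> a v \<in> carrier_vec n" "0 \<le> c"
  shows "psd_on V (\<lambda>u v. c * (d u * d v * (a u \<bullet> a v)))"
  unfolding psd_on_def
proof (intro conjI allI)
  show "symmetric_on V (\<lambda>u v. c * (d u * d v * (a u \<bullet> a v)))"
    unfolding symmetric_on_def
    using assms(1) by (metis comm_scalar_prod mult.commute)
next
  fix z :: "'a \<Rightarrow> real"
  have "(\<Sum>u\<in>V. \<Sum>v\<in>V. z u * (c * (d u * d v * (a u \<bullet> a v))) * z v)
      = (\<Sum>u\<in>V. \<Sum>v\<in>V. \<Sum>i<n. c * ((z u * d u * a u $ i) * (z v * d v * a v $ i)))"
  proof (intro sum.cong refl)
    fix u v assume "u \<in> V" "v \<in> V"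
    then have "dim_vec (a v) = n" using assms(1) by auto
    then show "z u * (c * (d u * d v * (a u \<bullet> a v))) * z v
      = (\<Sum>i<n. c * ((z u * d u * a u $ i) * (z v * d v * a v $ i)))"
      by (simp add: scalar_prod_def sum_distrib_left sum_distrib_right mult_ac
          lessThan_atLeast0)
  qed
  also have "\<dots> = (\<Sum>i<n. \<Sum>u\<in>V. \<Sum>v\<in>V. c * ((z u * d u * a u $ i) * (z v * d v * a v $ i)))"
    by (simp add: sum.swap[of _ "{..<n}"])
  also have "\<dots> = (\<Sum>i<n. c * (\<Sum>u\<in>V. z u * d u * a u $ i)\<^sup>2)"
    unfolding power2_eq_square sum_product by (simp only: sum_distrib_left)
  also have "0 \<le> \<dots>"
    using assms(2) by (intro sum_nonneg) simp
  finally show "0 \<le> (\<Sum>u\<in>V. \<Sum>v\<in>V. z u * (c * (d u * d v * (a u \<bullet> a v))) * z v)" .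
qed

section \<open>Closedness under entrywise limits\<close>

lemma psd_on_LIMSEQ:
  assumes "\<And>k. psd_on V (M k)"
    and lim: "\<And>u v. u \<in> V \<Longrightarrow> v \<in> V \<Longrightarrow> (\<lambda>k. M k u v) \<longlonglongrightarrow> N u v"
  shows "psd_on V N"
  unfolding psd_on_def
proof (intro conjI allI)
  show "symmetric_on V N"
    unfolding symmetric_on_def
  proof (intro ballI)
    fix u v assume uv: "u \<in> V" "v \<in> V"
    have "(\<lambda>k. M k u v) = (\<lambda>k. M k v u)"
      using assms(1) uv by (auto simp: psd_on_def symmetric_on_def)
    then show "N u v = N v u"
      using lim[OF uv] lim[OF uv(2,1)] LIMSEQ_unique by metis
  qed
next
  fix z :: "'a \<Rightarrow> real"
  have "(\<lambda>k. \<Sum>u\<in>V. \<Sum>v\<in>V. z u * M k u v * z v) \<longlonglongrightarrow> (\<Sum>u\<in>V. \<Sum>v\<in>V. z u * N u v * z v)"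
    by (intro tendsto_sum tendsto_mult tendsto_const lim)
  moreover have "0 \<le> (\<Sum>u\<in>V. \<Sum>v\<in>V. z u * M k u v * z v)" for k
    using assms(1)[of k] by (simp add: psd_on_def)
  ultimately show "0 \<le> (\<Sum>u\<in>V. \<Sum>v\<in>V. z u * N u v * z v)"
    by (intro LIMSEQ_le_const) auto
qed

section \<open>Homomorphisms and feasible solutions\<close>

text \<open>Bolzano-Weierstrass for finitely many coordinates: each new coordinate has a monotone
  subsequence, which converges by boundedness, and passing to it preserves the convergence of the
  earlier coordinates.\<close>

lemma finite_bounded_convergent_subseq:
  fixes x :: "nat \<Rightarrow> 'i \<Rightarrow> real"
  assumes "finite I" "\<And>k i. i \<in> I \<Longrightarrow> \<bar>x k i\<bar> \<le> B"
  shows "\<exists>r. strict_mono r \<and> (\<forall>i\<in>I. convergent (\<lambda>k. x (r k) i))"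
  using assms
proof (induction I rule: finite_induct)
  case empty
  show ?case by (intro exI[of _ id]) (simp add: strict_mono_def)
next
  case (insert j I)
  then obtain r where r: "strict_mono r" "\<And>i. i \<in> I \<Longrightarrow> convergent (\<lambda>k. x (r k) i)"
    by auto
  obtain r' where r': "strict_mono r'" "monoseq (\<lambda>k. x (r (r' k)) j)"
    using seq_monosub[of "\<lambda>k. x (r k) j"] by auto
  have "Bseq (\<lambda>k. x (r (r' k)) j)"
    using insert.prems by (intro BseqI'[of _ B]) simp
  then have "convergent (\<lambda>k. x (r (r' k)) j)"
    using r'(2) Bseq_monoseq_convergent by blast
  moreover have "convergent (\<lambda>k. x (r (r' k)) i)" if "i \<in> I" for i
    using convergent_subseq_convergent[OF r(2)[OF that] r'(1)] by (simp add: o_def)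
  moreover have "strict_mono (\<lambda>k. r (r' k))"
    using r(1) r'(1) by (simp add: strict_mono_def)
  ultimately show ?case by (intro exI[of _ "\<lambda>k. r (r' k)"]) auto
qed

section \<open>The signed sphere in components\<close>

lemma hinner_R:
  assumes "x \<in> H p q" "y \<in> H p q"
  shows "hinner x (R y) = fst x \<bullet> fst y - snd x \<bullet> snd y"
  using assms by (auto simp: hinner_def R_def H_def)

text \<open>Unit norm and the condition on \<open>hinner x (R x)\<close> prescribe the sum and the
  difference of the two squared component norms.\<close>

lemma sphere_verts_iff:
  "x \<in> sphere_verts p q t \<longleftrightarrow>
    x \<in> H p q \<and> fst x \<bullet> fst x = (1 + gam t) / 2 \<and> snd x \<bullet> snd x = (1 - gam t) / 2"
  by (auto simp: sphere_verts_def hnorm_def hinner_R) (auto simp: hinner_def)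

text \<open>\<open>R\<close> flips the sign of the second component, so both kinds of adjacency
  become one equation with the edge sign as a coefficient, as in the program.\<close>

lemma sphere_edge_iff:
  assumes x: "x \<in> sphere_verts p q t" and y: "y \<in> sphere_verts p q t" and s: "s \<in> {1, -1}"
  shows "({x, y}, s) \<in> sedges (signed_sphere p q t) \<longleftrightarrow>
    fst x \<bullet> fst y - of_int s * (snd x \<bullet> snd y) = gam t"
proof -
  have H: "x \<in> H p q" "y \<in> H p q" using x y by (auto simp: sphere_verts_iff)
  have comm: "fst y \<bullet> fst x = fst x \<bullet> fst y" "snd y \<bullet> snd x = snd x \<bullet> snd y"
    using H by (auto simp: H_def intro: comm_scalar_prod)
  \<comment> \<open>Edges are unordered pairs, so an edge may come with its endpoints swapped;
    symmetry of both conditions covers this.\<close>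
  have c: "hinner y x = hinner x y" "hinner y (R x) = hinner x (R y)"
    unfolding hinner_R[OF H] hinner_R[OF H(2,1)] by (simp_all add: hinner_def comm)
  have "({x, y}, -1) \<in> sedges (signed_sphere p q t) \<longleftrightarrow> hinner x y = gam t"
    unfolding signed_sphere_def using x y c(1) by (auto simp: doubleton_eq_iff simp del: split_paired_Ex)
  moreover have "({x, y}, 1) \<in> sedges (signed_sphere p q t) \<longleftrightarrow> hinner x (R y) = gam t"
    unfolding signed_sphere_def using x y c(2) by (auto simp: doubleton_eq_iff simp del: split_paired_Ex)
  ultimately show ?thesis
    using s hinner_R[OF H] by (auto simp: hinner_def)
qed

section \<open>Translation between homomorphisms and feasible solutions\<close>

lemma sdp_feasible_ge_1:
  assumes "finite (verts S)" "verts S \<noteq> {}" "sdp_feasible S t X Y"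
  shows "1 \<le> t"
proof -
  obtain v where v: "v \<in> verts S" using assms by blast
  have "0 \<le> X v v"
    using psd_on_diag[OF assms(1) _ v] assms(3) unfolding sdp_feasible_def by blast
  moreover have "X v v = t - 1" using assms(3) v by (simp add: sdp_feasible_def)
  ultimately show ?thesis by simp
qed

text \<open>The rescaled Gram vectors of \<open>X\<close> and \<open>Y\<close> are the two
  components of the image points. The trivial switching suffices.\<close>

lemma sdp_feasible_imp_hom:
  assumes fin: "finite (verts S)" and sg: "signed_graph S" and "1 \<le> t"
    and feas: "sdp_feasible S t X Y"
  shows "\<exists>p q \<tau> f. signed_hom S (signed_sphere p q t) \<tau> f"
proof -
  let ?n = "card (verts S)"
  obtain a where a: "\<And>v. a v \<in> carrier_vec ?n"
      "\<And>u v. u \<in> verts S \<Longrightarrow> v \<in> verts S \<Longrightarrow> X u v = a u \<bullet> a v"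
    using psd_on_gram[OF fin] feas unfolding sdp_feasible_def by metis
  obtain b where b: "\<And>v. b v \<in> carrier_vec ?n"
      "\<And>u v. u \<in> verts S \<Longrightarrow> v \<in> verts S \<Longrightarrow> Y u v = b u \<bullet> b v"
    using psd_on_gram[OF fin] feas unfolding sdp_feasible_def by metis
  \<comment> \<open>Scaling vectors by \<open>c\<close> divides inner products by
    \<open>2 * t - 1\<close>, which turns the right-hand side -1 into \<open>gam t\<close> and the
    diagonals \<open>t - 1\<close> and \<open>t\<close> into the squared norms required on the
    sphere.\<close>
  define c where "c = 1 / sqrt (2 * t - 1)"
  have cc: "c * c = 1 / (2 * t - 1)" using \<open>1 \<le> t\<close> by (simp add: c_def)
  have gam: "gam t = - (1 / (2 * t - 1))"
    unfolding gam_def by (metis minus_diff_eq minus_divide_right)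
  define f where "f = (\<lambda>v. (c \<cdot>\<^sub>v a v, c \<cdot>\<^sub>v b v))"
  have fst: "fst (f u) \<bullet> fst (f v) = X u v / (2 * t - 1)"
    if "u \<in> verts S" "v \<in> verts S" for u v
  proof -
    have "fst (f u) \<bullet> fst (f v) = (c * c) * (a u \<bullet> a v)"
      using a(1)[of u] a(1)[of v] by (simp add: f_def)
    then show ?thesis using a(2)[OF that] by (simp add: cc)
  qed
  have snd: "snd (f u) \<bullet> snd (f v) = Y u v / (2 * t - 1)"
    if "u \<in> verts S" "v \<in> verts S" for u v
  proof -
    have "snd (f u) \<bullet> snd (f v) = (c * c) * (b u \<bullet> b v)"
      using b(1)[of u] b(1)[of v] by (simp add: f_def)
    then show ?thesis using b(2)[OF that] by (simp add: cc)
  qed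
  have vert: "f v \<in> sphere_verts ?n ?n t" if v: "v \<in> verts S" for v
  proof -
    have "X v v = t - 1" "Y v v = t" using feas v by (auto simp: sdp_feasible_def)
    moreover have "f v \<in> H ?n ?n" using a(1) b(1) by (simp add: f_def H_def)
    ultimately show ?thesis
      using \<open>1 \<le> t\<close> by (auto simp: sphere_verts_iff fst[OF v v] snd[OF v v] gam field_simps)
  qed
  have edge: "({f u, f v}, 1 * s * 1) \<in> sedges (signed_sphere ?n ?n t)"
    if uv: "u \<in> verts S" "v \<in> verts S" "({u, v}, s) \<in> sedges S" for u v s
  proof -
    have s: "s \<in> {1, -1}" using sg uv(3) by (auto simp: signed_graph_def)
    have "X u v - of_int s * Y u v = -1" using feas uv by (auto simp: sdp_feasible_def)
    then have "(X u v - of_int s * Y u v) / (2 * t - 1) = gam t" by (simp add: gam)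
    then show ?thesis
      using sphere_edge_iff[OF vert[OF uv(1)] vert[OF uv(2)] s] fst[OF uv(1,2)] snd[OF uv(1,2)]
      by (simp add: diff_divide_distrib)
  qed
  have "signed_hom S (signed_sphere ?n ?n t) (\<lambda>_. 1) f"
    using vert edge by (auto simp: signed_hom_def signed_sphere_def)
  then show ?thesis by blast
qed

lemma hom_imp_sdp_feasible:
  assumes sg: "signed_graph S" and "1 \<le> t"
    and hom: "signed_hom S (signed_sphere p q t) \<tau> f"
  shows "\<exists>X Y. sdp_feasible S t X Y"
proof -
  \<comment> \<open>The factors \<open>1 * 1\<close> fit the shape of
    \<open>psd_on_scalar_prod\<close>. Only \<open>Y\<close> meets the edge sign in the constraints,
    so only \<open>Y\<close> absorbs the switching: \<open>\<tau> u * s * \<tau> v\<close> becomes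
    \<open>s\<close>.\<close>
  define X where "X = (\<lambda>u v. (2 * t - 1) * (1 * 1 * (fst (f u) \<bullet> fst (f v))))"
  define Y where "Y = (\<lambda>u v. (2 * t - 1) * (of_int (\<tau> u) * of_int (\<tau> v) * (snd (f u) \<bullet> snd (f v))))"
  have vert: "f v \<in> sphere_verts p q t" and \<tau>: "\<tau> v \<in> {1, -1}" if "v \<in> verts S" for v
    using hom that by (auto simp: signed_hom_def signed_sphere_def)
  have H: "f v \<in> H p q" if "v \<in> verts S" for v
    using vert[OF that] by (simp add: sphere_verts_iff)
  have gam: "(2 * t - 1) * gam t = -1" using \<open>1 \<le> t\<close> by (simp add: gam_def field_simps)
  have "psd_on (verts S) X"
    unfolding X_def using \<open>1 \<le> t\<close> H
    by (intro psd_on_scalar_prod[where n = p]) (auto simp: H_def mem_Times_iff)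
  moreover have "psd_on (verts S) Y"
    unfolding Y_def using \<open>1 \<le> t\<close> H
    by (intro psd_on_scalar_prod[where n = q]) (auto simp: H_def mem_Times_iff)
  moreover have "X v v = t - 1" "Y v v = t" if "v \<in> verts S" for v
  proof -
    have sq: "of_int (\<tau> v) * of_int (\<tau> v) = (1 :: real)" using \<tau>[OF that] by auto
    have norms: "fst (f v) \<bullet> fst (f v) = (1 + gam t) / 2"
        "snd (f v) \<bullet> snd (f v) = (1 - gam t) / 2"
      using vert[OF that] by (simp_all add: sphere_verts_iff)
    \<comment> \<open>Multiplied out, \<open>gam t\<close> occurs only in the product
      \<open>(2 * t - 1) * gam t\<close>, which is -1.\<close>
    have "X v v = ((2 * t - 1) + (2 * t - 1) * gam t) / 2"
        "Y v v = ((2 * t - 1) - (2 * t - 1) * gam t) / 2"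
      by (simp_all only: X_def Y_def sq norms mult_1 times_divide_eq_right
          distrib_left right_diff_distrib mult_1_right)
    then show "X v v = t - 1" "Y v v = t"
      unfolding gam by simp_all
  qed
  moreover have "X u v - of_int s * Y u v = -1"
    if uv: "u \<in> verts S" "v \<in> verts S" "({u, v}, s) \<in> sedges S" for u v s
  proof -
    have "s \<in> {1, -1}" using sg uv(3) by (auto simp: signed_graph_def)
    then have s: "\<tau> u * s * \<tau> v \<in> {1, -1}" using \<tau>[OF uv(1)] \<tau>[OF uv(2)] by auto
    have "({f u, f v}, \<tau> u * s * \<tau> v) \<in> sedges (signed_sphere p q t)"
      using hom uv by (auto simp: signed_hom_def)
    then have "fst (f u) \<bullet> fst (f v) - of_int (\<tau> u * s * \<tau> v) * (snd (f u) \<bullet> snd (f v)) = gam t"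
      using sphere_edge_iff[OF vert[OF uv(1)] vert[OF uv(2)] s] by simp
    then have "(2 * t - 1) * (fst (f u) \<bullet> fst (f v)
        - of_int (\<tau> u * s * \<tau> v) * (snd (f u) \<bullet> snd (f v))) = -1"
      using gam by simp
    then show ?thesis by (simp add: X_def Y_def algebra_simps)
  qed
  ultimately show ?thesis unfolding sdp_feasible_def by blast
qed

section \<open>A feasible value and attainment of the optimum\<close>

lemma ex_sdp_feasible_card:
  assumes fin: "finite (verts S)" and sg: "signed_graph S"
  shows "\<exists>X Y. sdp_feasible S (card (verts S)) X Y"
proof -
  let ?n = "real (card (verts S))"
  define X :: "'a \<Rightarrow> 'a \<Rightarrow> real" where "X = (\<lambda>u v. (if u = v then ?n else 0) - 1)"
  define Y :: "'a \<Rightarrow> 'a \<Rightarrow> real" where "Y = (\<lambda>u v. if u = v then ?n else 0)"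
  have diag: "(\<Sum>u\<in>verts S. \<Sum>v\<in>verts S. z u * Y u v * z v) = ?n * (\<Sum>u\<in>verts S. (z u)\<^sup>2)" for z
  proof -
    have "(\<Sum>v\<in>verts S. z u * Y u v * z v) = ?n * (z u)\<^sup>2" if "u \<in> verts S" for u
    proof -
      have "(\<Sum>v\<in>verts S. z u * Y u v * z v) = (\<Sum>v\<in>verts S. if u = v then ?n * (z u)\<^sup>2 else 0)"
        by (intro sum.cong) (auto simp: Y_def power2_eq_square)
      then show ?thesis using fin that by simp
    qed
    then show ?thesis by (simp add: sum_distrib_left)
  qed
  have "0 \<le> (\<Sum>u\<in>verts S. \<Sum>v\<in>verts S. z u * X u v * z v)" for z
  proof -
    have "(\<Sum>u\<in>verts S. \<Sum>v\<in>verts S. z u * X u v * z v)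
        = (\<Sum>u\<in>verts S. \<Sum>v\<in>verts S. z u * Y u v * z v) - (\<Sum>u\<in>verts S. \<Sum>v\<in>verts S. z u * z v)"
      by (simp add: X_def Y_def sum_subtractf[symmetric] algebra_simps)
    also have "\<dots> = ?n * (\<Sum>u\<in>verts S. (z u)\<^sup>2) - (\<Sum>u\<in>verts S. z u)\<^sup>2"
      by (simp only: diag power2_eq_square sum_product)
    finally have eq: "(\<Sum>u\<in>verts S. \<Sum>v\<in>verts S. z u * X u v * z v)
        = ?n * (\<Sum>u\<in>verts S. (z u)\<^sup>2) - (\<Sum>u\<in>verts S. z u)\<^sup>2" .
    \<comment> \<open>Cauchy-Schwarz against the all-ones vector, by summing
      \<open>2 * z u * z v \<le> (z u)\<^sup>2 + (z v)\<^sup>2\<close> over all pairs.\<close>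
    have "2 * (\<Sum>u\<in>verts S. z u)\<^sup>2 = (\<Sum>u\<in>verts S. \<Sum>v\<in>verts S. 2 * z u * z v)"
      unfolding power2_eq_square sum_product by (simp only: sum_distrib_left mult.assoc)
    also have "\<dots> \<le> (\<Sum>u\<in>verts S. \<Sum>v\<in>verts S. (z u)\<^sup>2 + (z v)\<^sup>2)"
      by (intro sum_mono sum_squares_bound)
    also have "\<dots> = 2 * (?n * (\<Sum>u\<in>verts S. (z u)\<^sup>2))"
      by (simp add: sum.distrib sum_distrib_left)
    finally show ?thesis unfolding eq by simp
  qed
  then have "psd_on (verts S) X"
    by (auto simp: psd_on_def symmetric_on_def X_def)
  moreover have "psd_on (verts S) Y"
    by (auto simp: psd_on_def symmetric_on_def diag sum_nonneg) (auto simp: Y_def)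
  moreover have "X u v - of_int s * Y u v = -1" if "({u, v}, s) \<in> sedges S" for u v s
  proof -
    \<comment> \<open>Off the diagonal \<open>X\<close> is -1 and \<open>Y\<close> is 0, so the sign
      does not matter. On a loop the exclusion of negative loops gives
      \<open>(?n - 1) - ?n = -1\<close>.\<close>
    have "s = 1" if "u = v"
      using sg \<open>({u, v}, s) \<in> sedges S\<close> that by (fastforce simp: signed_graph_def)
    then show ?thesis by (auto simp: X_def Y_def)
  qed
  ultimately have "sdp_feasible S ?n X Y"
    by (auto simp: sdp_feasible_def) (auto simp: X_def Y_def)
  then show ?thesis by blast
qed

lemma sdp_feasible_LIMSEQ:
  assumes fin: "finite (verts S)" and lim: "T \<longlonglongrightarrow> t"
    and feas: "\<And>k. sdp_feasible S (T k) (X k) (Y k)"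
  shows "\<exists>X Y. sdp_feasible S t X Y"
proof -
  let ?V = "verts S"
  obtain B where B: "\<And>k. \<bar>T k\<bar> \<le> B"
    using lim convergentI convergent_imp_Bseq by (metis Bseq_def real_norm_def)
  \<comment> \<open>The Boolean index merges both matrices into one family, so that a single
    subsequence works for all entries of both.\<close>
  define x where "x = (\<lambda>k (c, u, v). if c then X k u v else Y k u v)"
  have bound: "\<bar>x k i\<bar> \<le> B + 1" if mem: "i \<in> UNIV \<times> ?V \<times> ?V" for k i
  proof -
    obtain c u v where i: "i = (c, u, v)" "u \<in> ?V" "v \<in> ?V" using mem by auto
    have f: "psd_on ?V (X k)" "psd_on ?V (Y k)" "X k u u = T k - 1" "X k v v = T k - 1"
      "Y k u u = T k" "Y k v v = T k"
      using feas[of k] i by (auto simp: sdp_feasible_def)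
    show ?thesis
      using psd_on_abs_le[OF fin f(1) i(2,3)] psd_on_abs_le[OF fin f(2) i(2,3)] f(3-6) B[of k]
      by (auto simp: x_def i(1))
  qed
  have "finite (UNIV \<times> ?V \<times> ?V :: (bool \<times> _) set)" using fin by simp
  from finite_bounded_convergent_subseq[where x = x, OF this bound]
  obtain r where r: "strict_mono r"
      "\<And>i. i \<in> UNIV \<times> ?V \<times> ?V \<Longrightarrow> convergent (\<lambda>k. x (r k) i)"
    by blast
  define X' where "X' = (\<lambda>u v. lim (\<lambda>k. X (r k) u v))"
  define Y' where "Y' = (\<lambda>u v. lim (\<lambda>k. Y (r k) u v))"
  have X': "(\<lambda>k. X (r k) u v) \<longlonglongrightarrow> X' u v" and Y': "(\<lambda>k. Y (r k) u v) \<longlonglongrightarrow> Y' u v"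
    if "u \<in> ?V" "v \<in> ?V" for u v
    using r(2)[of "(True, u, v)"] r(2)[of "(False, u, v)"] that
    by (auto simp: x_def X'_def Y'_def convergent_LIMSEQ_iff)
  have T: "(\<lambda>k. T (r k)) \<longlonglongrightarrow> t"
    using LIMSEQ_subseq_LIMSEQ[OF lim r(1)] by (simp add: o_def)
  have "psd_on ?V X'"
    using feas by (intro psd_on_LIMSEQ[OF _ X']) (auto simp: sdp_feasible_def)
  moreover have "psd_on ?V Y'"
    using feas by (intro psd_on_LIMSEQ[OF _ Y']) (auto simp: sdp_feasible_def)
  moreover have "X' v v = t - 1" "Y' v v = t" if "v \<in> ?V" for v
  proof -
    have "(\<lambda>k. X (r k) v v) = (\<lambda>k. T (r k) - 1)" "(\<lambda>k. Y (r k) v v) = (\<lambda>k. T (r k))"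
      using feas that by (auto simp: sdp_feasible_def)
    then show "X' v v = t - 1" "Y' v v = t"
      using X'[OF that that] Y'[OF that that] T tendsto_diff[OF T tendsto_const[of 1]]
      by (auto intro: LIMSEQ_unique)
  qed
  moreover have "X' u v - of_int s * Y' u v = -1"
    if "u \<in> ?V" "v \<in> ?V" "({u, v}, s) \<in> sedges S" for u v s
  proof -
    have "(\<lambda>k. X (r k) u v - of_int s * Y (r k) u v) \<longlonglongrightarrow> X' u v - of_int s * Y' u v"
      using X' Y' that by (intro tendsto_intros) auto
    \<comment> \<open>Along the subsequence the edge expression is constantly -1, hence so is its
      limit.\<close>
    moreover have "(\<lambda>k. X (r k) u v - of_int s * Y (r k) u v) = (\<lambda>_. -1)"
      using feas that by (auto simp: sdp_feasible_def)
    ultimately show ?thesis by (simp add: LIMSEQ_const_iff)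
  qed
  ultimately show ?thesis unfolding sdp_feasible_def by blast
qed

lemma signed_graph_add_pos_loops:
  assumes "signed_graph S"
  shows "signed_graph (add_pos_loops S)"
  using assms unfolding signed_graph_def add_pos_loops_def by fastforce

theorem theorem4p1:
  fixes S :: "'v sgraph"
  assumes "signed_graph S"
    and "finite (verts S)"
    and "verts S \<noteq> {}"
  shows "(\<exists>X Y. sdp_feasible (add_pos_loops S) (theta_b S) X Y) \<and>
         (\<forall>t X Y. sdp_feasible (add_pos_loops S) t X Y \<longrightarrow> theta_b S \<le> t)"
proof -
  let ?S = "add_pos_loops S"
  have S: "signed_graph ?S" "finite (verts ?S)" "verts ?S \<noteq> {}"
    using assms signed_graph_add_pos_loops by (auto simp: add_pos_loops_def)
  define F where "F = {t. \<exists>X Y. sdp_feasible ?S t X Y}"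
  have F1: "1 \<le> t" if "t \<in> F" for t
    using that sdp_feasible_ge_1[OF S(2,3)] by (auto simp: F_def)
  \<comment> \<open>The admissible values of the homomorphism problem are exactly the feasible
    values; \<open>F1\<close> supplies \<open>t \<ge> 1\<close>.\<close>
  have "{t. t \<ge> 1 \<and> (\<exists>p q \<tau> f. signed_hom ?S (signed_sphere p q t) \<tau> f)} = F"
  proof (intro equalityI subsetI)
    fix t assume "t \<in> {t. t \<ge> 1 \<and> (\<exists>p q \<tau> f. signed_hom ?S (signed_sphere p q t) \<tau> f)}"
    then show "t \<in> F"
      using hom_imp_sdp_feasible[OF S(1)] unfolding F_def by blast
  next
    fix t assume "t \<in> F"
    then show "t \<in> {t. t \<ge> 1 \<and> (\<exists>p q \<tau> f. signed_hom ?S (signed_sphere p q t) \<tau> f)}"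
      using F1 sdp_feasible_imp_hom[OF S(2,1)] unfolding F_def by blast
  qed
  then have theta: "theta_b S = Inf F" by (simp add: theta_b_def)
  have bdd: "bdd_below F" using F1 by (rule bdd_belowI)
  have "F \<noteq> {}" using ex_sdp_feasible_card[OF S(2,1)] by (auto simp: F_def)
  \<comment> \<open>A minimizing sequence of feasible values: its limit \<open>Inf F\<close> is
    feasible by \<open>sdp_feasible_LIMSEQ\<close>, so the infimum is a minimum.\<close>
  then have "\<exists>t\<in>F. t < Inf F + 1 / real (Suc k)" for k
    using cInf_lessD[of F "Inf F + 1 / real (Suc k)"] by simp
  then obtain T where T: "\<And>k. T k \<in> F" "\<And>k. T k < Inf F + 1 / real (Suc k)" by metis
  have "T \<longlonglongrightarrow> Inf F"
  proof (rule real_tendsto_sandwich[OF _ _ tendsto_const])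
    show "\<forall>\<^sub>F k in sequentially. Inf F \<le> T k"
      using T(1) bdd by (intro always_eventually allI cInf_lower)
    show "\<forall>\<^sub>F k in sequentially. T k \<le> Inf F + 1 / real (Suc k)"
      using T(2) by (intro always_eventually allI less_imp_le)
    show "(\<lambda>k. Inf F + 1 / real (Suc k)) \<longlonglongrightarrow> Inf F"
      using tendsto_add[OF tendsto_const LIMSEQ_inverse_real_of_nat, of "Inf F"]
      by (simp add: inverse_eq_divide)
  qed
  moreover obtain X Y where "\<And>k. sdp_feasible ?S (T k) (X k) (Y k)"
    using T(1) unfolding F_def mem_Collect_eq by metis
  ultimately have "\<exists>X Y. sdp_feasible ?S (Inf F) X Y"
    by (rule sdp_feasible_LIMSEQ[OF S(2)])
  moreover have "Inf F \<le> t" if "sdp_feasible ?S t X Y" for t X Y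
    using that bdd by (intro cInf_lower) (auto simp: F_def)
  ultimately show ?thesis unfolding theta by blast
qed

end
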